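(* Let $r\ge 1$ be an integer and let $G$ be a $K_{r+1}$-free graph of order $n$. Then \[\frac{q_n(G)}{n}\le\left(1-\frac{1}{r}\right)^2.\]
   Context: Graphs are finite, simple and have a nonempty vertex set; the order of a graph is its number of vertices. The signless Laplacian matrix of $G$ is $Q(G)=D(G)+A(G)$, where $A(G)$ is the adjacency matrix and $D(G)$ is the diagonal matrix of vertex degrees. Its eigenvalues are $q_1(G)\ge q_2(G)\ge\cdots\ge q_n(G)\ge 0$, so $q_n(G)$ is the least one. A graph is $K_{r+1}$-free if it contains no clique on $r+1$ vertices. *)

theory Defs
  imports
    "Graph_Theory.Kuratowski"
    "Jordan_Normal_Form.Char_Poly"
begin

text \<open>
  A finite simple graph is a \<open>pair_graph\<close> of Graph_Theory: an undirected edge \<open>uv\<close> is represented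
  by the two arcs \<open>(u, v)\<close> and \<open>(v, u)\<close>, so that the degree of a vertex is its out-degree.
\<close>

definition K_free :: "nat \<Rightarrow> 'a pair_pre_digraph \<Rightarrow> bool" where
  "K_free k G \<longleftrightarrow>
     \<not> (\<exists>H :: 'a pair_pre_digraph. subgraph (with_proj H) (with_proj G) \<and> complete_digraph k (with_proj H))"

text \<open>
  Matrices are indexed by natural numbers, so the vertices are listed in an arbitrary order.
  A different order conjugates the matrices below by a permutation matrix, which leaves
  the eigenvalues unchanged.
\<close>

definition vertex_list :: "'a pair_pre_digraph \<Rightarrow> 'a list" where
  "vertex_list G = (SOME vs. distinct vs \<and> set vs = pverts G)"

definition adjacency_mat :: "'a pair_pre_digraph \<Rightarrow> real mat" where
  "adjacency_mat G = (let vs = vertex_list G; n = length vs in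
     mat n n (\<lambda>(i, j). if (vs ! i, vs ! j) \<in> parcs G then 1 else 0))"

definition degree_mat :: "'a pair_pre_digraph \<Rightarrow> real mat" where
  "degree_mat G = (let vs = vertex_list G; n = length vs in
     mat n n (\<lambda>(i, j). if i = j then real (out_degree (with_proj G) (vs ! i)) else 0))"

definition signless_laplacian :: "'a pair_pre_digraph \<Rightarrow> real mat" where
  "signless_laplacian G = degree_mat G + adjacency_mat G"

text \<open>
  The real eigenvalues of a matrix, repeated according to algebraic multiplicity,
  in non-increasing order.
\<close>

definition eigenvalue_list :: "real mat \<Rightarrow> real list" where
  "eigenvalue_list A = rev (sorted_list_of_multiset (proots (char_poly A)))"

text \<open>Eigenvalues are numbered from 1: \<open>signless_q G 1 \<ge> \<dots> \<ge> signless_q G n\<close>.\<close>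

definition signless_q :: "'a pair_pre_digraph \<Rightarrow> nat \<Rightarrow> real" where
  "signless_q G k = eigenvalue_list (signless_laplacian G) ! (k - 1)"

lemma vertex_list:
  assumes "finite (pverts G)"
  shows "distinct (vertex_list G)" "set (vertex_list G) = pverts G"
    "length (vertex_list G) = card (pverts G)"
proof -
  have "\<exists>vs. distinct vs \<and> set vs = pverts G"
    using finite_distinct_list[OF assms] by blast
  from someI_ex[OF this] show *: "distinct (vertex_list G)" "set (vertex_list G) = pverts G"
    by (auto simp: vertex_list_def)
  show "length (vertex_list G) = card (pverts G)"
    using distinct_card[OF *(1)] *(2) by simp
qed

lemma symmetric_mat_eigenvalue_real:
  fixes A :: "real mat"
  assumes A: "A \<in> carrier_mat n n"
    and sym: "\<And>i j. i < n \<Longrightarrow> j < n \<Longrightarrow> A $$ (i, j) = A $$ (j, i)"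
    and ev: "eigenvalue (map_mat complex_of_real A) c"
  shows "c \<in> \<real>"
proof -
  from ev A obtain v where v: "v \<in> carrier_vec n" "v \<noteq> 0\<^sub>v n"
    and eq: "map_mat complex_of_real A *\<^sub>v v = c \<cdot>\<^sub>v v"
    by (auto simp: eigenvalue_def eigenvector_def)
  have comp: "(\<Sum>j<n. of_real (A $$ (i, j)) * v $ j) = c * v $ i" if "i < n" for i
  proof -
    have "(map_mat complex_of_real A *\<^sub>v v) $ i = (\<Sum>j<n. of_real (A $$ (i, j)) * v $ j)"
      using that v A by (auto simp: scalar_prod_def atLeast0LessThan intro!: sum.cong)
    with eq that v show ?thesis by simp
  qed
  define S where "S = (\<Sum>i<n. \<Sum>j<n. cnj (v $ i) * of_real (A $$ (i, j)) * v $ j)"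
  define N where "N = (\<Sum>i<n. (cmod (v $ i))\<^sup>2)"
  have "S = (\<Sum>i<n. cnj (v $ i) * (c * v $ i))"
    unfolding S_def by (intro sum.cong refl) (simp add: comp[symmetric] sum_distrib_left mult.assoc)
  also have "\<dots> = c * of_real N"
    unfolding N_def of_real_sum sum_distrib_left
    by (intro sum.cong refl) (simp only: complex_norm_square mult_ac)
  finally have S: "S = c * of_real N" .
  have "cnj S = (\<Sum>i<n. \<Sum>j<n. cnj (v $ j) * of_real (A $$ (i, j)) * v $ i)"
    unfolding S_def cnj_sum by (intro sum.cong refl) (simp add: mult_ac)
  also have "\<dots> = (\<Sum>j<n. \<Sum>i<n. cnj (v $ j) * of_real (A $$ (i, j)) * v $ i)"
    by (rule sum.swap)
  also have "\<dots> = S"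
    unfolding S_def by (intro sum.cong refl) (simp add: sym)
  finally have "cnj c * of_real N = c * of_real N" using S by simp
  moreover have "N > 0"
  proof -
    from v obtain i where "i < n" "v $ i \<noteq> 0" by (metis carrier_vecD eq_vecI index_zero_vec)
    then show ?thesis unfolding N_def by (intro sum_pos2[of _ i]) auto
  qed
  ultimately show ?thesis by (simp add: Reals_cnj_iff)
qed

lemma length_eigenvalue_list:
  assumes A: "A \<in> carrier_mat n n"
    and sym: "\<And>i j. i < n \<Longrightarrow> j < n \<Longrightarrow> A $$ (i, j) = A $$ (j, i)"
  shows "length (eigenvalue_list A) = n"
proof -
  interpret ofr: map_poly_inj_idom_hom complex_of_real ..
  let ?C = "map_mat complex_of_real A"
  have C: "?C \<in> carrier_mat n n" using A by simp
  from char_poly_factorized[OF C] obtain as where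
    as: "char_poly ?C = (\<Prod>a\<leftarrow>as. [:- a, 1:])" "length as = n" by blast
  have "a \<in> \<real>" if "a \<in> set as" for a
  proof (rule symmetric_mat_eigenvalue_real[OF A sym])
    have "poly (char_poly ?C) a = 0"
      unfolding as(1) poly_prod_list using that by (force simp: prod_list_zero_iff)
    then show "eigenvalue ?C a" using eigenvalue_root_char_poly[OF C] by simp
  qed auto
  then have "as = map (of_real \<circ> Re) as"
    by (intro nth_equalityI) (auto simp: of_real_Re)
  then obtain bs where bs: "as = map complex_of_real bs" by (metis map_map)
  have "map_poly complex_of_real (char_poly A) = char_poly ?C"
    by (rule of_real_hom.char_poly_hom[OF A, symmetric])
  also have "\<dots> = map_poly complex_of_real (\<Prod>b\<leftarrow>bs. [:- b, 1:])"
    unfolding as(1) bs by (simp add: ofr.hom_prod_list o_def)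
  finally have "char_poly A = (\<Prod>b\<leftarrow>bs. [:- b, 1:])"
    by (simp add: ofr.eq_iff)
  moreover have "proots (\<Prod>b\<leftarrow>bs. [:- b, 1:]) = mset bs"
  proof (induction bs)
    case (Cons b bs)
    have "(\<Prod>b\<leftarrow>bs. [:- b, 1:]) \<noteq> 0" by (auto simp: prod_list_zero_iff)
    with Cons show ?case by (simp add: proots_mult del: mult_pCons_left)
  qed simp
  ultimately have "mset (eigenvalue_list A) = mset bs"
    by (simp add: eigenvalue_list_def)
  then show ?thesis using as(2) bs by (metis length_map size_mset)
qed

lemma signless_laplacian_carrier:
  assumes "finite (pverts G)"
  shows "signless_laplacian G \<in> carrier_mat (card (pverts G)) (card (pverts G))"
  using vertex_list(3)[OF assms]
  by (simp add: signless_laplacian_def degree_mat_def adjacency_mat_def Let_def)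

lemma length_signless_eigenvalue_list:
  assumes "pair_graph G"
  shows "length (eigenvalue_list (signless_laplacian G)) = card (pverts G)"
proof -
  interpret pair_graph G by (rule assms)
  have sym: "(u, v) \<in> parcs G \<longleftrightarrow> (v, u) \<in> parcs G" for u v
    using pair_sym_arcs by (auto simp: symmetric_def dest: symD)
  show ?thesis
    by (rule length_eigenvalue_list[OF signless_laplacian_carrier[OF pair_finite_verts]])
      (auto simp: signless_laplacian_def degree_mat_def adjacency_mat_def Let_def sym
        vertex_list(3)[OF pair_finite_verts])
qed

lemma signless_q_least:
  assumes "pair_graph G" and "pverts G \<noteq> {}"
  shows "eigenvalue (signless_laplacian G) (signless_q G (card (pverts G)))"
    and "eigenvalue (signless_laplacian G) k \<Longrightarrow> signless_q G (card (pverts G)) \<le> k"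
proof -
  interpret pair_graph G by (rule assms)
  let ?Q = "signless_laplacian G" and ?n = "card (pverts G)"
  have Q: "?Q \<in> carrier_mat ?n ?n" by (rule signless_laplacian_carrier[OF pair_finite_verts])
  have n: "?n > 0" using assms(2) pair_finite_verts by (simp add: card_gt_0_iff)
  have nz: "char_poly ?Q \<noteq> 0" using degree_monic_char_poly[OF Q] by auto
  let ?s = "sorted_list_of_multiset (proots (char_poly ?Q))"
  have len: "length ?s = ?n"
    using length_signless_eigenvalue_list[OF assms(1)] by (simp add: eigenvalue_list_def)
  have set: "set ?s = {k. eigenvalue ?Q k}"
    using nz by (auto simp: eigenvalue_root_char_poly[OF Q])
  have q: "signless_q G ?n = ?s ! 0"
    using n len by (simp add: signless_q_def eigenvalue_list_def rev_nth)
  show "eigenvalue ?Q (signless_q G ?n)"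
    using set q n len by (metis mem_Collect_eq nth_mem)
  show "signless_q G ?n \<le> k" if "eigenvalue ?Q k"
  proof -
    from that set obtain i where "i < length ?s" "k = ?s ! i"
      by (metis in_set_conv_nth mem_Collect_eq)
    then show ?thesis unfolding q by (auto intro: sorted_nth_mono)
  qed
qed

end

theory Submission
  imports Defs "HOL-Analysis.Convex" "HOL-Analysis.Function_Topology"
begin

text \<open>
  Let \<open>E\<close> be the number of arcs (twice the number of edges) and \<open>r \<ge> 2\<close>. Choose a vertex \<open>v\<close>,
  give one colour to all its non-neighbours and colour the \<open>K\<^sub>r\<close>-free graph on its neighbourhood
  recursively with \<open>r - 1\<close> colours, as in Fueredi's proof of the stability of Turan's theorem.
  Averaging over \<open>v\<close> yields an \<open>r\<close>-colouring with
  \<open>I \<le> E - r / (r - 1) * (E / n)\<^sup>2\<close> monochromatic arcs. Evaluating the form of the signless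
  Laplacian at the vectors that are \<open>r - 1\<close> on one colour class and \<open>- 1\<close> elsewhere gives
  \<open>(r - 1) * n * q \<le> (r - 2) * E + r * I\<close>. Together, with \<open>a = 1 - 1 / r\<close> and \<open>e = E / n\<^sup>2\<close>,
  \<open>q / n \<le> 2 * e - (e / a)\<^sup>2 \<le> a\<^sup>2\<close>.
\<close>

section \<open>Rayleigh quotients\<close>

text \<open>Near \<open>t = 0\<close> the linear term dominates. The choice
  \<open>t = - c / m\<close> with \<open>m > 0\<close> and \<open>k \<le> m\<close> already makes
  the expression at most \<open>- (c\<^sup>2 / m)\<close>.\<close>

lemma linear_coeff_zero_of_nonneg:
  fixes c k :: real
  assumes "\<And>t. 0 \<le> 2 * t * c + t\<^sup>2 * k"
  shows "c = 0"
proof (rule ccontr)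
  assume c: "c \<noteq> 0"
  define m where "m = \<bar>k\<bar> + 1"
  have m: "m > 0" "k \<le> m" by (auto simp: m_def)
  have "0 \<le> 2 * (- c / m) * c + (- c / m)\<^sup>2 * k" by (rule assms)
  also have "\<dots> \<le> 2 * (- c / m) * c + (- c / m)\<^sup>2 * m"
    using m by (intro add_left_mono mult_left_mono) auto
  also have "\<dots> = - (c\<^sup>2 / m)"
    using m by (simp add: power2_eq_square field_simps)
  also have "\<dots> < 0" using c m by simp
  finally show False by simp
qed

text \<open>A zero of a nonnegative form is a minimiser, so its gradient vanishes there. Moving from
  \<open>x\<close> along the half-gradient \<open>g\<close> to \<open>x + t * g\<close> gives a
  polynomial in \<open>t\<close> without constant term, whose linear coefficient is twice the
  squared norm of \<open>g\<close>.\<close>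

lemma quadratic_form_null_vector:
  fixes b :: "'i \<Rightarrow> 'i \<Rightarrow> real"
  assumes fin: "finite V"
    and sym: "\<And>i j. i \<in> V \<Longrightarrow> j \<in> V \<Longrightarrow> b i j = b j i"
    and nonneg: "\<And>y. 0 \<le> (\<Sum>i\<in>V. \<Sum>j\<in>V. b i j * y i * y j)"
    and null: "(\<Sum>i\<in>V. \<Sum>j\<in>V. b i j * x i * x j) = 0"
    and "i \<in> V"
  shows "(\<Sum>j\<in>V. b i j * x j) = 0"
proof -
  define g where "g i = (\<Sum>j\<in>V. b i j * x j)" for i
  have cross: "(\<Sum>i\<in>V. \<Sum>j\<in>V. b i j * x i * g j) = (\<Sum>i\<in>V. (g i)\<^sup>2)"
  proof -
    have "(\<Sum>i\<in>V. \<Sum>j\<in>V. b i j * x i * g j) = (\<Sum>j\<in>V. \<Sum>i\<in>V. b i j * x i * g j)"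
      by (rule sum.swap)
    also have "\<dots> = (\<Sum>j\<in>V. g j * (\<Sum>i\<in>V. b j i * x i))"
      unfolding sum_distrib_left by (intro sum.cong refl) (simp add: sym mult_ac)
    finally show ?thesis by (simp add: g_def power2_eq_square)
  qed
  have cross': "(\<Sum>i\<in>V. \<Sum>j\<in>V. b i j * g i * x j) = (\<Sum>i\<in>V. (g i)\<^sup>2)"
    by (simp add: g_def power2_eq_square sum_distrib_left mult_ac)
  have "0 \<le> 2 * t * (\<Sum>i\<in>V. (g i)\<^sup>2) + t\<^sup>2 * (\<Sum>i\<in>V. \<Sum>j\<in>V. b i j * g i * g j)" for t
  proof -
    have "0 \<le> (\<Sum>i\<in>V. \<Sum>j\<in>V. b i j * (x i + t * g i) * (x j + t * g j))" by (rule nonneg)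
    also have "\<dots> = (\<Sum>i\<in>V. \<Sum>j\<in>V. b i j * x i * x j) + t * (\<Sum>i\<in>V. \<Sum>j\<in>V. b i j * x i * g j)
        + t * (\<Sum>i\<in>V. \<Sum>j\<in>V. b i j * g i * x j) + t\<^sup>2 * (\<Sum>i\<in>V. \<Sum>j\<in>V. b i j * g i * g j)"
      by (simp add: sum_distrib_left sum.distrib[symmetric] algebra_simps power2_eq_square)
    finally show ?thesis by (simp add: null cross cross')
  qed
  from linear_coeff_zero_of_nonneg[OF this] have "(\<Sum>i\<in>V. (g i)\<^sup>2) = 0" .
  with fin \<open>i \<in> V\<close> show ?thesis by (simp add: sum_nonneg_eq_0_iff g_def)
qed

text \<open>Tychonoff's theorem, applied to a product of intervals over the whole index
  type.\<close>

lemma compact_function_box: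
  fixes l u :: "'i \<Rightarrow> real"
  shows "compact {x. \<forall>i. l i \<le> x i \<and> x i \<le> u i}"
proof -
  have "compactin (product_topology (\<lambda>i. euclidean) UNIV) (PiE UNIV (\<lambda>i. {l i..u i}))"
    by (subst compactin_PiE) (auto simp: compactin_euclidean_iff)
  moreover have "PiE UNIV (\<lambda>i. {l i..u i}) = {x. \<forall>i. l i \<le> x i \<and> x i \<le> u i}" by auto
  ultimately show ?thesis by (simp add: euclidean_product_topology compactin_euclidean_iff)
qed

text \<open>The form attains its minimum \<open>l\<close> on the unit sphere at some
  \<open>x\<close>. After subtracting \<open>l\<close> times the squared norm, the form is
  nonnegative and vanishes at \<open>x\<close>, so \<open>x\<close> is a null vector of the shifted
  matrix, that is, an eigenvector for \<open>l\<close>.\<close>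

lemma least_eigenvalue_rayleigh:
  fixes a :: "'i \<Rightarrow> 'i \<Rightarrow> real"
  assumes fin: "finite V" and ne: "V \<noteq> {}"
    and sym: "\<And>i j. i \<in> V \<Longrightarrow> j \<in> V \<Longrightarrow> a i j = a j i"
  obtains l x where "\<exists>i\<in>V. x i \<noteq> 0"
    and "\<forall>i\<in>V. (\<Sum>j\<in>V. a i j * x j) = l * x i"
    and "\<forall>y. l * (\<Sum>i\<in>V. (y i)\<^sup>2) \<le> (\<Sum>i\<in>V. \<Sum>j\<in>V. a i j * y i * y j)"
proof -
  define q where "q y = (\<Sum>i\<in>V. \<Sum>j\<in>V. a i j * y i * y j)" for y
  define N where "N y = (\<Sum>i\<in>V. (y i)\<^sup>2)" for y :: "'i \<Rightarrow> real"
  \<comment> \<open>The functions live on the whole type \<open>'i\<close>; pinning the coordinates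
    outside \<open>V\<close> to 0 makes the unit sphere over \<open>V\<close> a compact set of
    functions.\<close>
  define box where "box = {x :: 'i \<Rightarrow> real. \<forall>i. (if i \<in> V then -1 else 0) \<le> x i \<and> x i \<le> (if i \<in> V then 1 else 0)}"
  have coord: "continuous_on UNIV (\<lambda>x :: 'i \<Rightarrow> real. x i)" for i
    by simp
  have contN: "continuous_on UNIV N"
    unfolding N_def by (intro continuous_intros coord)
  have contq: "continuous_on UNIV q"
    unfolding q_def by (intro continuous_intros coord)
  have "closed {x. N x = 1}"
    using continuous_closed_preimage[OF contN, of "{1}"] by (simp add: vimage_def)
  moreover have "compact box"
    unfolding box_def by (rule compact_function_box)
  ultimately have comp: "compact (box \<inter> {x. N x = 1})"
    by (rule compact_Int_closed[rotated])
  from ne obtain i0 where i0: "i0 \<in> V" by blast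
  have "(\<lambda>i. if i = i0 then 1 else 0) \<in> box \<inter> {x. N x = 1}"
    using i0 fin by (auto simp: box_def N_def if_distrib[where f = "\<lambda>z. z\<^sup>2"] sum.delta cong: if_cong)
  then have "box \<inter> {x. N x = 1} \<noteq> {}" by blast
  from continuous_attains_inf[OF comp this continuous_on_subset[OF contq]]
  obtain x where x: "x \<in> box" "N x = 1"
    and min: "\<And>y. y \<in> box \<Longrightarrow> N y = 1 \<Longrightarrow> q x \<le> q y" by auto
  have le: "q x * N y \<le> q y" for y
  proof (cases "N y = 0")
    case True
    then have "\<forall>i\<in>V. y i = 0" using fin by (simp add: N_def sum_nonneg_eq_0_iff)
    then show ?thesis by (simp add: q_def N_def)
  next
    case False
    then have pos: "N y > 0" by (metis N_def less_eq_real_def sum_nonneg zero_le_power2)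
    define s where "s = sqrt (N y)"
    have s: "s > 0" "s\<^sup>2 = N y" using pos by (auto simp: s_def)
    \<comment> \<open>\<open>y\<close> is normalised, and cut off outside \<open>V\<close> so that
      it lies in \<open>box\<close>; neither \<open>q\<close> nor \<open>N\<close> sees the values
      outside \<open>V\<close>.\<close>
    define z where "z i = (if i \<in> V then y i / s else 0)" for i
    have "N z = (\<Sum>i\<in>V. (y i)\<^sup>2 / s\<^sup>2)"
      unfolding N_def z_def by (intro sum.cong) (auto simp: power_divide)
    then have Nz: "N z = 1" using s pos by (simp add: sum_divide_distrib[symmetric] N_def[symmetric])
    have "(z i)\<^sup>2 \<le> 1" if "i \<in> V" for i
      unfolding Nz[symmetric] N_def using that fin by (intro member_le_sum) auto
    then have "- 1 \<le> z i \<and> z i \<le> 1" if "i \<in> V" for i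
      using that by (simp add: abs_square_le_1 abs_le_iff minus_le_iff)
    then have "z \<in> box" by (simp add: box_def) (simp add: z_def)
    then have "q x \<le> q z" using Nz by (rule min)
    also have "q z = (\<Sum>i\<in>V. \<Sum>j\<in>V. a i j * y i * y j / s\<^sup>2)"
      unfolding q_def z_def by (intro sum.cong) (auto simp: power2_eq_square)
    also have "\<dots> = q y / N y"
      by (simp add: sum_divide_distrib[symmetric] q_def[symmetric] s)
    finally show ?thesis using pos by (simp add: field_simps)
  qed
  define b where "b i j = a i j - (if i = j then q x else 0)" for i j
  have b_form: "(\<Sum>i\<in>V. \<Sum>j\<in>V. b i j * y i * y j) = q y - q x * N y" for y
  proof -
    have "(\<Sum>j\<in>V. b i j * y i * y j) = (\<Sum>j\<in>V. a i j * y i * y j) - q x * (y i)\<^sup>2" if "i \<in> V" for i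
    proof -
      have "(\<Sum>j\<in>V. b i j * y i * y j) = (\<Sum>j\<in>V. a i j * y i * y j - (if j = i then q x * (y i)\<^sup>2 else 0))"
        by (intro sum.cong) (auto simp: b_def algebra_simps power2_eq_square)
      then show ?thesis using fin that by (simp add: sum_subtractf)
    qed
    then show ?thesis by (simp add: q_def N_def sum_subtractf sum_distrib_left)
  qed
  show thesis
  proof (rule that)
    show "\<exists>i\<in>V. x i \<noteq> 0"
      using x(2) unfolding N_def by (rule contrapos_pp) simp
    show "\<forall>i\<in>V. (\<Sum>j\<in>V. a i j * x j) = q x * x i"
    proof
      fix i assume i: "i \<in> V"
      have "(\<Sum>j\<in>V. b i j * x j) = 0"
      proof (rule quadratic_form_null_vector[OF fin _ _ _ i])
        show "b i j = b j i" if "i \<in> V" "j \<in> V" for i j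
          using that sym by (simp add: b_def)
      qed (use le x(2) in \<open>auto simp: b_form\<close>)
      moreover have "(\<Sum>j\<in>V. b i j * x j) = (\<Sum>j\<in>V. a i j * x j - (if j = i then q x * x i else 0))"
        by (intro sum.cong) (auto simp: b_def algebra_simps)
      ultimately show "(\<Sum>j\<in>V. a i j * x j) = q x * x i"
        using fin i by (simp add: sum_subtractf)
    qed
    show "\<forall>y. q x * (\<Sum>i\<in>V. (y i)\<^sup>2) \<le> (\<Sum>i\<in>V. \<Sum>j\<in>V. a i j * y i * y j)"
      using le by (simp add: q_def N_def)
  qed
qed

text \<open>The minimum \<open>l\<close> of the Rayleigh quotient is itself an eigenvalue, so every
  lower bound \<open>q\<close> of the spectrum satisfies \<open>q \<le> l\<close>.\<close>

lemma symmetric_mat_rayleigh: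
  fixes A :: "real mat"
  assumes A: "A \<in> carrier_mat n n" and "n > 0"
    and sym: "\<And>i j. i < n \<Longrightarrow> j < n \<Longrightarrow> A $$ (i, j) = A $$ (j, i)"
    and least: "\<And>k. eigenvalue A k \<Longrightarrow> q \<le> k"
  shows "q * (\<Sum>i<n. (y i)\<^sup>2) \<le> (\<Sum>i<n. \<Sum>j<n. A $$ (i, j) * y i * y j)"
proof -
  have "finite {..<n}" "{..<n} \<noteq> {}" using \<open>n > 0\<close> by auto
  moreover have "A $$ (i, j) = A $$ (j, i)" if "i \<in> {..<n}" "j \<in> {..<n}" for i j
    using that sym by simp
  ultimately obtain l x where nz: "\<exists>i\<in>{..<n}. x i \<noteq> 0"
    and eig: "\<forall>i\<in>{..<n}. (\<Sum>j<n. A $$ (i, j) * x j) = l * x i"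
    and le: "\<forall>y. l * (\<Sum>i<n. (y i)\<^sup>2) \<le> (\<Sum>i<n. \<Sum>j<n. A $$ (i, j) * y i * y j)"
    by (rule least_eigenvalue_rayleigh[where a = "\<lambda>i j. A $$ (i, j)"]) blast
  have "eigenvector A (vec n x) l"
    unfolding eigenvector_def
  proof (intro conjI)
    show "vec n x \<in> carrier_vec (dim_row A)" using A by simp
    show "vec n x \<noteq> 0\<^sub>v (dim_row A)" using A nz by (auto simp: vec_eq_iff)
    show "A *\<^sub>v vec n x = l \<cdot>\<^sub>v vec n x"
      using A by (intro eq_vecI) (auto simp: scalar_prod_def atLeast0LessThan eig[rule_format, symmetric] intro!: sum.cong)
  qed
  then have "q \<le> l" using least by (auto simp: eigenvalue_def)
  then have "q * (\<Sum>i<n. (y i)\<^sup>2) \<le> l * (\<Sum>i<n. (y i)\<^sup>2)"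
    by (intro mult_right_mono sum_nonneg) auto
  with le[rule_format, of y] show ?thesis by linarith
qed

section \<open>Colourings with few monochromatic arcs\<close>

text \<open>Ordered pairs are counted: for symmetric irreflexive \<open>R\<close>, the case
  \<open>S = T\<close> gives twice the number of edges inside \<open>S\<close>.\<close>

definition arc_count :: "'a rel \<Rightarrow> 'a set \<Rightarrow> 'a set \<Rightarrow> real" where
  "arc_count R S T = (\<Sum>u\<in>S. \<Sum>v\<in>T. of_bool ((u, v) \<in> R))"

definition mono_arc_count :: "'a rel \<Rightarrow> ('a \<Rightarrow> 'b) \<Rightarrow> 'a set \<Rightarrow> real" where
  "mono_arc_count R f S = arc_count (R \<inter> {(u, v). f u = f v}) S S"

text \<open>Stated for a relation and a vertex set, so that passing to a neighbourhood only shrinks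
  \<open>S\<close> and needs no induced subgraph.\<close>

definition clique_free :: "nat \<Rightarrow> 'a rel \<Rightarrow> 'a set \<Rightarrow> bool" where
  "clique_free k R S \<longleftrightarrow>
     \<not> (\<exists>C\<subseteq>S. finite C \<and> card C = k \<and> (\<forall>u\<in>C. \<forall>v\<in>C. u \<noteq> v \<longrightarrow> (u, v) \<in> R))"

lemma arc_count_commute: "sym R \<Longrightarrow> arc_count R S T = arc_count R T S"
  unfolding arc_count_def by (subst sum.swap) (intro sum.cong refl, auto dest: symD)

lemma arc_count_Un_left:
  "finite S \<Longrightarrow> finite S' \<Longrightarrow> S \<inter> S' = {} \<Longrightarrow>
    arc_count R (S \<union> S') T = arc_count R S T + arc_count R S' T"
  by (simp add: arc_count_def sum.union_disjoint)

lemma arc_count_Un_right: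
  "finite T \<Longrightarrow> finite T' \<Longrightarrow> T \<inter> T' = {} \<Longrightarrow>
    arc_count R S (T \<union> T') = arc_count R S T + arc_count R S T'"
  unfolding arc_count_def by (simp only: sum.union_disjoint sum.distrib)

lemma arc_count_cong:
  "(\<And>u v. u \<in> S \<Longrightarrow> v \<in> T \<Longrightarrow> (u, v) \<in> R \<longleftrightarrow> (u, v) \<in> R') \<Longrightarrow> arc_count R S T = arc_count R' S T"
  by (simp add: arc_count_def)

lemma arc_count_eq_0:
  "(\<And>u v. u \<in> S \<Longrightarrow> v \<in> T \<Longrightarrow> (u, v) \<notin> R) \<Longrightarrow> arc_count R S T = 0"
  by (simp add: arc_count_def)

text \<open>The colour \<open>s\<close> is new, so no arc between \<open>N\<close> and
  \<open>S - N\<close> is monochromatic, while all arcs inside \<open>S - N\<close> are. Arcs inside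
  \<open>S - N\<close> thus count twice on the left, and each edge between \<open>N\<close> and
  \<open>S - N\<close> contributes its two arcs; together this is twice the number of arcs leaving
  \<open>S - N\<close>.\<close>

lemma mono_arc_count_extend:
  fixes g :: "'a \<Rightarrow> nat"
  assumes fin: "finite S" and "sym R" and NS: "N \<subseteq> S" and g: "\<forall>u\<in>N. g u < s"
  defines "f \<equiv> \<lambda>u. if u \<in> N then g u else s"
  shows "arc_count R S S + mono_arc_count R f S
    = arc_count R N N + mono_arc_count R g N + 2 * arc_count R (S - N) S"
proof -
  define C where "C = S - N"
  have S: "S = N \<union> C" and fins: "finite N" "finite C" and disj: "N \<inter> C = {}"
    using fin NS by (auto simp: C_def intro: finite_subset)
  note split = arc_count_Un_left[OF fins disj] arc_count_Un_right[OF fins disj]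
  let ?M = "R \<inter> {(u, v). f u = f v}"
  have "arc_count ?M N N = mono_arc_count R g N"
    unfolding mono_arc_count_def by (rule arc_count_cong) (auto simp: f_def)
  moreover have "arc_count ?M N C = 0" "arc_count ?M C N = 0"
    using g disj by (auto intro!: arc_count_eq_0 simp: f_def split: if_splits)
  moreover have "arc_count ?M C C = arc_count R C C"
    using disj by (intro arc_count_cong) (auto simp: f_def)
  ultimately have "mono_arc_count R f S = mono_arc_count R g N + arc_count R C C"
    unfolding mono_arc_count_def S by (simp add: split)
  moreover have "arc_count R S S = arc_count R N N + 2 * arc_count R C N + arc_count R C C"
    unfolding S by (simp add: split arc_count_commute[OF \<open>sym R\<close>, of N C])
  moreover have "arc_count R C S = arc_count R C N + arc_count R C C"
    unfolding S by (simp add: split)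
  ultimately show ?thesis by (simp add: C_def)
qed

text \<open>
  Colouring the non-neighbours of \<open>v\<close> with one new colour and averaging over all \<open>v\<close> gains,
  by Cauchy-Schwarz for the degrees, over the choice of a vertex of maximum degree.
\<close>

lemma averaged_colouring:
  fixes R :: "'a rel" and s :: nat
  assumes fin: "finite S" and "sym R"
    and nbh: "\<And>v. v \<in> S \<Longrightarrow> \<exists>g. (\<forall>u\<in>{u\<in>S. (v, u) \<in> R}. g u < s) \<and>
      real s * (arc_count R {u\<in>S. (v, u) \<in> R} {u\<in>S. (v, u) \<in> R}
          + mono_arc_count R g {u\<in>S. (v, u) \<in> R})
        \<le> (real s - 1) * (real (card {u\<in>S. (v, u) \<in> R}))\<^sup>2"
  shows "\<exists>f. (\<forall>u\<in>S. f u < Suc s) \<and>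
    real s * (real (card S))\<^sup>2 * mono_arc_count R f S + (real s + 1) * (arc_count R S S)\<^sup>2
      \<le> real s * (real (card S))\<^sup>2 * arc_count R S S"
proof (cases "S = {}")
  case True
  then show ?thesis by (simp add: arc_count_def mono_arc_count_def)
next
  case False
  define N where "N v = {u\<in>S. (v, u) \<in> R}" for v
  define d where "d v = (\<Sum>u\<in>S. of_bool ((v, u) \<in> R) :: real)" for v
  define n where "n = real (card S)"
  define E where "E = arc_count R S S"
  have n: "n > 0" using False fin by (simp add: n_def card_gt_0_iff)
  have cardN: "real (card (N v)) = d v" for v
    using fin by (simp add: N_def d_def sum_of_bool_eq Int_def)
  have E: "E = sum d S" by (simp add: E_def arc_count_def d_def)
  from nbh obtain g where g: "\<And>v. v \<in> S \<Longrightarrow> \<forall>u\<in>N v. g v u < s"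
    and gle: "\<And>v. v \<in> S \<Longrightarrow>
      real s * (arc_count R (N v) (N v) + mono_arc_count R (g v) (N v)) \<le> (real s - 1) * (d v)\<^sup>2"
    unfolding N_def[symmetric] cardN by metis
  define f where "f v = (\<lambda>u. if u \<in> N v then g v u else s)" for v
  define I where "I v = mono_arc_count R (f v) S" for v
  have rest: "arc_count R (S - N v) S = E - (\<Sum>u\<in>S. of_bool ((v, u) \<in> R) * d u)" for v
  proof -
    have "arc_count R (S - N v) S = sum d (S - N v)" by (simp add: arc_count_def d_def)
    also have "\<dots> = sum d S - sum d (N v)"
      using fin by (intro sum_diff) (auto simp: N_def)
    also have "sum d (N v) = (\<Sum>u\<in>S. of_bool ((v, u) \<in> R) * d u)"
      unfolding N_def using fin by (intro sum.mono_neutral_cong_left) auto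
    finally show ?thesis by (simp add: E)
  qed
  have bound: "real s * (E + I v)
      \<le> (real s - 1) * (d v)\<^sup>2 + 2 * real s * (E - (\<Sum>u\<in>S. of_bool ((v, u) \<in> R) * d u))" if "v \<in> S" for v
  proof -
    have "N v \<subseteq> S" by (auto simp: N_def)
    from mono_arc_count_extend[OF fin \<open>sym R\<close> this g[OF that]]
    have eq: "E + I v = arc_count R (N v) (N v) + mono_arc_count R (g v) (N v)
        + 2 * (E - (\<Sum>u\<in>S. of_bool ((v, u) \<in> R) * d u))"
      by (simp add: E_def I_def f_def rest[unfolded E_def])
    have "real s * (E + I v)
        = real s * (arc_count R (N v) (N v) + mono_arc_count R (g v) (N v))
          + 2 * real s * (E - (\<Sum>u\<in>S. of_bool ((v, u) \<in> R) * d u))"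
      unfolding eq by (simp add: distrib_left)
    also have "\<dots> \<le> (real s - 1) * (d v)\<^sup>2
        + 2 * real s * (E - (\<Sum>u\<in>S. of_bool ((v, u) \<in> R) * d u))"
      by (rule add_right_mono) (rule gle[OF that])
    finally show ?thesis .
  qed
  \<comment> \<open>Each \<open>u\<close> is a neighbour of exactly \<open>d u\<close> vertices
    \<open>v\<close>. Summing \<open>bound\<close> over \<open>v\<close> therefore leaves the sum of
    squared degrees with coefficient \<open>(s - 1) - 2 * s = - (s + 1)\<close>, and its sign is the
    right one for Cauchy-Schwarz.\<close>
  have "(\<Sum>v\<in>S. \<Sum>u\<in>S. of_bool ((v, u) \<in> R) * d u) = (\<Sum>u\<in>S. \<Sum>v\<in>S. of_bool ((v, u) \<in> R) * d u)"
    by (rule sum.swap)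
  also have "\<dots> = (\<Sum>u\<in>S. d u * d u)"
    unfolding d_def sum_distrib_right[symmetric] using \<open>sym R\<close>
    by (intro sum.cong refl arg_cong2[of _ _ _ _ "(*)"]) (auto dest: symD)
  finally have sq: "(\<Sum>v\<in>S. \<Sum>u\<in>S. of_bool ((v, u) \<in> R) * d u) = (\<Sum>v\<in>S. (d v)\<^sup>2)"
    by (simp add: power2_eq_square)
  have cs: "E\<^sup>2 \<le> n * (\<Sum>v\<in>S. (d v)\<^sup>2)"
    using sum_squared_le_sum_of_squares[of d S] fin by (simp add: E n_def mult.commute)
  have "(\<Sum>v\<in>S. real s * (E + I v)) \<le> (\<Sum>v\<in>S. (real s - 1) * (d v)\<^sup>2
      + 2 * real s * (E - (\<Sum>u\<in>S. of_bool ((v, u) \<in> R) * d u)))"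
    by (rule sum_mono) (rule bound)
  also have "\<dots> = 2 * real s * n * E - (real s + 1) * (\<Sum>v\<in>S. (d v)\<^sup>2)"
    by (simp only: sum.distrib sum_subtractf sum_distrib_left[symmetric] sq)
      (simp add: n_def algebra_simps)
  finally have "n * (\<Sum>v\<in>S. real s * (E + I v)) \<le> n * (2 * real s * n * E - (real s + 1) * (\<Sum>v\<in>S. (d v)\<^sup>2))"
    using n by (simp add: mult_left_mono)
  also have "\<dots> \<le> 2 * real s * n\<^sup>2 * E - (real s + 1) * E\<^sup>2"
    using mult_left_mono[OF cs, of "real s + 1"] by (simp add: algebra_simps power2_eq_square)
  finally have total: "n * (\<Sum>v\<in>S. real s * (E + I v)) \<le> 2 * real s * n\<^sup>2 * E - (real s + 1) * E\<^sup>2" .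
  \<comment> \<open>Some \<open>v\<close> does no worse than the average over
    \<open>S\<close>.\<close>
  have "\<exists>v\<in>S. n\<^sup>2 * (real s * (E + I v)) \<le> 2 * real s * n\<^sup>2 * E - (real s + 1) * E\<^sup>2"
  proof (rule ccontr)
    assume "\<not> ?thesis"
    then have "(\<Sum>v\<in>S. 2 * real s * n\<^sup>2 * E - (real s + 1) * E\<^sup>2) < (\<Sum>v\<in>S. n\<^sup>2 * (real s * (E + I v)))"
      using fin False by (intro sum_strict_mono) (auto simp: not_le)
    then have "n * (2 * real s * n\<^sup>2 * E - (real s + 1) * E\<^sup>2) < n * (n * (\<Sum>v\<in>S. real s * (E + I v)))"
      by (simp add: n_def[symmetric] sum_distrib_left[symmetric] power2_eq_square mult.assoc)
    with total n show False by (simp add: mult_less_cancel_left_pos)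
  qed
  then obtain v where "v \<in> S" "n\<^sup>2 * (real s * (E + I v)) \<le> 2 * real s * n\<^sup>2 * E - (real s + 1) * E\<^sup>2"
    by blast
  moreover have "\<forall>u\<in>S. f v u < Suc s"
    using g[OF \<open>v \<in> S\<close>] by (auto simp: f_def less_Suc_eq)
  ultimately show ?thesis
    unfolding n_def[symmetric] E_def[symmetric]
    by (intro exI[of _ "f v"]) (simp add: I_def[symmetric] algebra_simps)
qed

text \<open>Adding \<open>v\<close> to a clique of its neighbours gives a clique with one more
  vertex; irreflexivity guarantees that \<open>v\<close> is new.\<close>

lemma clique_free_neighbourhood:
  assumes "sym R" "irrefl R" "clique_free (Suc k) R S" "v \<in> S"
  shows "clique_free k R {u\<in>S. (v, u) \<in> R}"
  unfolding clique_free_def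
proof
  assume "\<exists>C\<subseteq>{u \<in> S. (v, u) \<in> R}. finite C \<and> card C = k \<and> (\<forall>u\<in>C. \<forall>v\<in>C. u \<noteq> v \<longrightarrow> (u, v) \<in> R)"
  then obtain C where C: "C \<subseteq> {u \<in> S. (v, u) \<in> R}" "finite C" "card C = k"
    "\<forall>u\<in>C. \<forall>v\<in>C. u \<noteq> v \<longrightarrow> (u, v) \<in> R" by blast
  from C(1) \<open>irrefl R\<close> have "v \<notin> C" by (auto simp: irrefl_def)
  with C have "card (insert v C) = Suc k" by simp
  moreover have "\<forall>x\<in>insert v C. \<forall>y\<in>insert v C. x \<noteq> y \<longrightarrow> (x, y) \<in> R"
    using C(1,4) \<open>sym R\<close> by (auto dest: symD)
  moreover have "insert v C \<subseteq> S" "finite (insert v C)" using C \<open>v \<in> S\<close> by auto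
  ultimately show False using assms(3) by (auto simp: clique_free_def)
qed

lemma clique_free_2_iff:
  assumes "sym R" "irrefl R"
  shows "clique_free 2 R S \<longleftrightarrow> (\<forall>u\<in>S. \<forall>v\<in>S. (u, v) \<notin> R)"
proof
  assume free: "clique_free 2 R S"
  show "\<forall>u\<in>S. \<forall>v\<in>S. (u, v) \<notin> R"
  proof (intro ballI notI)
    fix u v assume uv: "u \<in> S" "v \<in> S" "(u, v) \<in> R"
    with assms have "u \<noteq> v" "(v, u) \<in> R" by (auto simp: irrefl_def dest: symD)
    with uv free show False
      unfolding clique_free_def by (elim notE, intro exI[of _ "{u, v}"]) auto
  qed
next
  assume "\<forall>u\<in>S. \<forall>v\<in>S. (u, v) \<notin> R"
  then show "clique_free 2 R S"
    by (auto simp: clique_free_def card_2_iff)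
qed

text \<open>This is the bound that \<open>averaged_colouring\<close> expects on neighbourhoods;
  since the monochromatic count is nonnegative, it strengthens Turan's bound
  \<open>E \<le> (1 - 1 / s) * n\<^sup>2\<close> for the arc count. The induction closes because the
  quadratic bound of \<open>averaged_colouring\<close> implies the linear one for
  \<open>s + 1\<close> colours by completing a square.\<close>

lemma clique_free_colouring_weak:
  assumes "s \<ge> 1" "sym R" "irrefl R" "finite S" "clique_free (Suc s) R S"
  shows "\<exists>f. (\<forall>u\<in>S. f u < s) \<and>
    real s * (arc_count R S S + mono_arc_count R f S) \<le> (real s - 1) * (real (card S))\<^sup>2"
  using assms
proof (induction s arbitrary: S rule: nat_induct_at_least)
  case base
  then have "\<forall>u\<in>S. \<forall>v\<in>S. (u, v) \<notin> R" using clique_free_2_iff[of R S] by (simp add: numeral_2_eq_2)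
  then show ?case
    by (intro exI[of _ "\<lambda>_. 0"]) (simp add: mono_arc_count_def arc_count_eq_0)
next
  case (Suc s)
  define n where "n = real (card S)"
  define E where "E = arc_count R S S"
  have "\<exists>f. (\<forall>u\<in>S. f u < Suc s) \<and>
    real s * (real (card S))\<^sup>2 * mono_arc_count R f S + (real s + 1) * (arc_count R S S)\<^sup>2
      \<le> real s * (real (card S))\<^sup>2 * arc_count R S S"
    using Suc by (intro averaged_colouring Suc.IH clique_free_neighbourhood) auto
  then obtain f where f: "\<forall>u\<in>S. f u < Suc s"
    and le: "real s * n\<^sup>2 * mono_arc_count R f S + (real s + 1) * E\<^sup>2 \<le> real s * n\<^sup>2 * E"
    unfolding n_def E_def by blast
  define I where "I = mono_arc_count R f S"
  have "(real s + 1) * (E + I) \<le> real s * n\<^sup>2"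
  proof (cases "S = {}")
    case True
    then show ?thesis by (simp add: E_def I_def mono_arc_count_def arc_count_def)
  next
    case False
    then have pos: "real s * n\<^sup>2 > 0" using Suc by (simp add: n_def card_gt_0_iff)
    \<comment> \<open>The factor \<open>s * n\<^sup>2\<close> is the coefficient of the
      monochromatic count in \<open>le\<close>. After substitution a quadratic in \<open>E\<close>
      remains, and its completed square is dropped.\<close>
    have "real s * n\<^sup>2 * ((real s + 1) * (E + I))
        = (real s + 1) * (real s * n\<^sup>2 * I) + (real s + 1) * (real s * n\<^sup>2 * E)"
      by (simp add: algebra_simps)
    also have "\<dots> \<le> (real s + 1) * (real s * n\<^sup>2 * E - (real s + 1) * E\<^sup>2) + (real s + 1) * (real s * n\<^sup>2 * E)"
      using le by (intro add_right_mono mult_left_mono) (auto simp: I_def)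
    also have "\<dots> = (real s * n\<^sup>2)\<^sup>2 - (real s * n\<^sup>2 - (real s + 1) * E)\<^sup>2"
      by (simp add: power2_eq_square algebra_simps)
    also have "\<dots> \<le> real s * n\<^sup>2 * (real s * n\<^sup>2)"
      by (simp add: power2_eq_square)
    finally show ?thesis using pos by (simp add: mult_le_cancel_left_pos)
  qed
  then show ?case using f by (intro exI[of _ f]) (simp add: E_def I_def n_def add.commute)
qed

text \<open>One more round of averaging on top of the weak bound for neighbourhoods. The term
  quadratic in the arc count is kept here, since the final optimisation over that count relies on
  it.\<close>

lemma clique_free_colouring:
  assumes "s \<ge> 1" "sym R" "irrefl R" "finite S" "clique_free (Suc (Suc s)) R S"
  shows "\<exists>f. (\<forall>u\<in>S. f u < Suc s) \<and>
    real s * (real (card S))\<^sup>2 * mono_arc_count R f S + (real s + 1) * (arc_count R S S)\<^sup>2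
      \<le> real s * (real (card S))\<^sup>2 * arc_count R S S"
  using assms by (intro averaged_colouring clique_free_colouring_weak clique_free_neighbourhood) auto

section \<open>The signless Laplacian form\<close>

text \<open>The form is evaluated at \<open>r\<close> test vectors, one per colour \<open>k\<close>,
  equal to \<open>r - 1\<close> on class \<open>k\<close> and \<open>- 1\<close> elsewhere, and the
  inequalities are added. By symmetry among the colours the sums depend only on whether an arc is
  monochromatic; a common factor \<open>2 * r\<close> cancels.\<close>

lemma signless_form_colouring_bound:
  fixes f :: "'a \<Rightarrow> nat" and q :: real
  assumes fin: "finite V" and f: "\<forall>u\<in>V. f u < r" and "r \<ge> 1"
    and form: "\<And>y. 2 * q * (\<Sum>u\<in>V. (y u)\<^sup>2) \<le> (\<Sum>u\<in>V. \<Sum>v\<in>V. of_bool ((u, v) \<in> R) * (y u + y v)\<^sup>2)"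
  shows "q * real (card V) * (real r - 1)
    \<le> (real r - 2) * arc_count R V V + real r * mono_arc_count R f V"
proof -
  define w where "w k c = (if c = k then real r else 0) - 1" for k c :: nat
  \<comment> \<open>One value \<open>r - 1\<close> and \<open>r - 1\<close> values
    \<open>- 1\<close>: \<open>(r - 1)\<^sup>2 + (r - 1)\<close>.\<close>
  have w1: "(\<Sum>k<r. (w k c)\<^sup>2) = real r * (real r - 1)" if "c < r" for c
  proof -
    have "(\<Sum>k<r. (w k c)\<^sup>2) = (\<Sum>k<r. (if c = k then (real r)\<^sup>2 - 2 * real r else 0) + 1)"
      by (intro sum.cong) (auto simp: w_def power2_eq_square algebra_simps)
    then show ?thesis using that by (simp add: sum.distrib power2_eq_square algebra_simps)
  qed
  \<comment> \<open>Equal colours give four times \<open>w1\<close>. For distinct colours the sum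
    \<open>w k c + w k c'\<close> is \<open>r - 2\<close> for two values of \<open>k\<close> and
    \<open>- 2\<close> for the remaining \<open>r - 2\<close>.\<close>
  have w2: "(\<Sum>k<r. (w k c + w k c')\<^sup>2) = 2 * real r * ((real r - 2) + real r * of_bool (c = c'))"
    if "c < r" "c' < r" for c c'
  proof (cases "c = c'")
    case True
    have "(w k c + w k c)\<^sup>2 = 4 * (w k c)\<^sup>2" for k by (simp add: power2_eq_square algebra_simps)
    then show ?thesis using True w1[OF that(1)] by (simp add: sum_distrib_left[symmetric] algebra_simps)
  next
    case False
    have "(\<Sum>k<r. (w k c + w k c')\<^sup>2) = (\<Sum>k<r. (if c = k then (real r)\<^sup>2 - 4 * real r else 0)
        + (if c' = k then (real r)\<^sup>2 - 4 * real r else 0) + 4)"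
      using False by (intro sum.cong) (auto simp: w_def power2_eq_square algebra_simps)
    then show ?thesis using that False by (simp add: sum.distrib power2_eq_square algebra_simps)
  qed
  have "(\<Sum>k<r. \<Sum>u\<in>V. (w k (f u))\<^sup>2) = (\<Sum>u\<in>V. \<Sum>k<r. (w k (f u))\<^sup>2)"
    by (rule sum.swap)
  also have "\<dots> = real (card V) * (real r * (real r - 1))"
    using f by (simp add: w1)
  finally have left: "(\<Sum>k<r. \<Sum>u\<in>V. (w k (f u))\<^sup>2) = real (card V) * (real r * (real r - 1))" .
  have "(\<Sum>k<r. \<Sum>u\<in>V. \<Sum>v\<in>V. of_bool ((u, v) \<in> R) * (w k (f u) + w k (f v))\<^sup>2)
      = (\<Sum>u\<in>V. \<Sum>v\<in>V. \<Sum>k<r. of_bool ((u, v) \<in> R) * (w k (f u) + w k (f v))\<^sup>2)"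
    by (subst sum.swap, intro sum.cong refl, rule sum.swap)
  also have "\<dots> = (\<Sum>u\<in>V. \<Sum>v\<in>V. 2 * real r * (real r - 2) * of_bool ((u, v) \<in> R)
      + 2 * real r * real r * of_bool ((u, v) \<in> R \<inter> {(u, v). f u = f v}))"
    unfolding sum_distrib_left[symmetric]
    using f by (intro sum.cong refl) (auto simp: w2 algebra_simps)
  also have "\<dots> = 2 * real r * ((real r - 2) * arc_count R V V + real r * mono_arc_count R f V)"
    unfolding sum.distrib sum_distrib_left[symmetric] mono_arc_count_def arc_count_def
    by (simp add: algebra_simps)
  finally have right: "(\<Sum>k<r. \<Sum>u\<in>V. \<Sum>v\<in>V. of_bool ((u, v) \<in> R) * (w k (f u) + w k (f v))\<^sup>2)
      = 2 * real r * ((real r - 2) * arc_count R V V + real r * mono_arc_count R f V)" .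
  have "(\<Sum>k<r. 2 * q * (\<Sum>u\<in>V. (w k (f u))\<^sup>2))
      \<le> (\<Sum>k<r. \<Sum>u\<in>V. \<Sum>v\<in>V. of_bool ((u, v) \<in> R) * (w k (f u) + w k (f v))\<^sup>2)"
    by (intro sum_mono form)
  then have "2 * real r * (q * real (card V) * (real r - 1))
      \<le> 2 * real r * ((real r - 2) * arc_count R V V + real r * mono_arc_count R f V)"
    unfolding sum_distrib_left[symmetric] left right by (simp add: algebra_simps)
  then show ?thesis using \<open>r \<ge> 1\<close> by (simp add: mult_le_cancel_left_pos)
qed

lemma pair_graph_sym:
  fixes G :: "'a pair_pre_digraph"
  assumes "pair_graph G"
  shows "sym (parcs G)"
proof -
  interpret pair_graph G by (rule assms)
  from pair_sym_arcs show ?thesis by (simp add: symmetric_def)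
qed

text \<open>The signless Laplacian form is the sum of \<open>(y u + y v)\<^sup>2\<close> over edges;
  the factor 2 appears because each edge is two arcs. The degree of \<open>u\<close> is the number
  of arcs leaving it, so the diagonal spreads \<open>(y u)\<^sup>2\<close> over those arcs.\<close>

lemma signless_laplacian_form:
  fixes G :: "'a pair_pre_digraph"
  assumes G: "pair_graph G"
  defines "vs \<equiv> vertex_list G"
  shows "2 * (\<Sum>i<card (pverts G). \<Sum>j<card (pverts G).
        signless_laplacian G $$ (i, j) * y (vs ! i) * y (vs ! j))
    = (\<Sum>u\<in>pverts G. \<Sum>v\<in>pverts G. of_bool ((u, v) \<in> parcs G) * (y u + y v)\<^sup>2)"
proof -
  interpret pair_graph G by (rule assms)
  let ?V = "pverts G" and ?A = "parcs G" and ?n = "card (pverts G)"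
  have fin: "finite ?V" by (rule pair_finite_verts)
  note vs = vertex_list[OF fin, folded vs_def]
  have bij: "bij_betw ((!) vs) {..<?n} ?V"
    by (rule bij_betw_nth[OF vs(1) _ vs(2)[symmetric]]) (simp only: vs(3))
  have sym: "(u, v) \<in> ?A \<longleftrightarrow> (v, u) \<in> ?A" for u v
    using pair_graph_sym[OF G] unfolding sym_def by blast
  have deg: "real (out_degree (with_proj G) u) = (\<Sum>v\<in>?V. of_bool ((u, v) \<in> ?A))" for u
  proof -
    have "out_arcs (with_proj G) u = Pair u ` {v\<in>?V. (u, v) \<in> ?A}"
      by (auto simp: out_arcs_def dest: in_arcsD2)
    then have "out_degree (with_proj G) u = card {v\<in>?V. (u, v) \<in> ?A}"
      by (simp add: out_degree_def card_image inj_on_def)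
    then show ?thesis using fin by (simp add: sum_of_bool_eq Int_def)
  qed
  have entry: "signless_laplacian G $$ (i, j) = (if i = j then real (out_degree (with_proj G) (vs ! i)) else 0)
      + of_bool ((vs ! i, vs ! j) \<in> ?A)" if "i < ?n" "j < ?n" for i j
    using that vs(3) by (simp add: signless_laplacian_def degree_mat_def adjacency_mat_def Let_def vs_def)
  have row: "(\<Sum>j<?n. signless_laplacian G $$ (i, j) * y (vs ! i) * y (vs ! j))
      = (\<Sum>v\<in>?V. of_bool ((vs ! i, v) \<in> ?A) * (y (vs ! i))\<^sup>2)
        + (\<Sum>v\<in>?V. of_bool ((vs ! i, v) \<in> ?A) * (y (vs ! i) * y v))" if i: "i < ?n" for i
  proof -
    have "(\<Sum>j<?n. signless_laplacian G $$ (i, j) * y (vs ! i) * y (vs ! j))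
        = (\<Sum>j<?n. (if i = j then real (out_degree (with_proj G) (vs ! i)) * (y (vs ! i))\<^sup>2 else 0)
          + of_bool ((vs ! i, vs ! j) \<in> ?A) * (y (vs ! i) * y (vs ! j)))"
      using i by (intro sum.cong) (auto simp: entry power2_eq_square algebra_simps)
    also have "\<dots> = real (out_degree (with_proj G) (vs ! i)) * (y (vs ! i))\<^sup>2
          + (\<Sum>j<?n. of_bool ((vs ! i, vs ! j) \<in> ?A) * (y (vs ! i) * y (vs ! j)))"
      using i by (simp add: sum.distrib)
    also have "(\<Sum>j<?n. of_bool ((vs ! i, vs ! j) \<in> ?A) * (y (vs ! i) * y (vs ! j)))
        = (\<Sum>v\<in>?V. of_bool ((vs ! i, v) \<in> ?A) * (y (vs ! i) * y v))"
      by (rule sum.reindex_bij_betw[OF bij])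
    finally show ?thesis by (simp add: deg sum_distrib_right)
  qed
  have "(\<Sum>i<?n. \<Sum>j<?n. signless_laplacian G $$ (i, j) * y (vs ! i) * y (vs ! j))
      = (\<Sum>i<?n. (\<Sum>v\<in>?V. of_bool ((vs ! i, v) \<in> ?A) * (y (vs ! i))\<^sup>2)
        + (\<Sum>v\<in>?V. of_bool ((vs ! i, v) \<in> ?A) * (y (vs ! i) * y v)))"
    by (intro sum.cong refl row) simp
  also have "\<dots> = (\<Sum>u\<in>?V. (\<Sum>v\<in>?V. of_bool ((u, v) \<in> ?A) * (y u)\<^sup>2)
        + (\<Sum>v\<in>?V. of_bool ((u, v) \<in> ?A) * (y u * y v)))"
    by (rule sum.reindex_bij_betw[OF bij])
  finally have form: "(\<Sum>i<?n. \<Sum>j<?n. signless_laplacian G $$ (i, j) * y (vs ! i) * y (vs ! j))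
      = (\<Sum>u\<in>?V. \<Sum>v\<in>?V. of_bool ((u, v) \<in> ?A) * (y u)\<^sup>2)
        + (\<Sum>u\<in>?V. \<Sum>v\<in>?V. of_bool ((u, v) \<in> ?A) * (y u * y v))"
    by (simp add: sum.distrib)
  \<comment> \<open>Reversing all arcs turns squares at heads into squares at tails, so both equal
    the diagonal part.\<close>
  have swap: "(\<Sum>u\<in>?V. \<Sum>v\<in>?V. of_bool ((u, v) \<in> ?A) * (y v)\<^sup>2)
      = (\<Sum>u\<in>?V. \<Sum>v\<in>?V. of_bool ((u, v) \<in> ?A) * (y u)\<^sup>2)"
    by (subst sum.swap) (simp add: sym)
  have "(\<Sum>u\<in>?V. \<Sum>v\<in>?V. of_bool ((u, v) \<in> ?A) * (y u + y v)\<^sup>2)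
      = (\<Sum>u\<in>?V. \<Sum>v\<in>?V. of_bool ((u, v) \<in> ?A) * (y u)\<^sup>2)
        + (\<Sum>u\<in>?V. \<Sum>v\<in>?V. of_bool ((u, v) \<in> ?A) * (y v)\<^sup>2)
        + 2 * (\<Sum>u\<in>?V. \<Sum>v\<in>?V. of_bool ((u, v) \<in> ?A) * (y u * y v))"
    by (simp add: sum_distrib_left sum.distrib[symmetric] power2_eq_square algebra_simps)
  then show ?thesis unfolding form swap by (simp only: distrib_left mult_2)
qed

lemma signless_q_least_form:
  fixes G :: "'a pair_pre_digraph"
  assumes G: "pair_graph G" and ne: "pverts G \<noteq> {}"
  shows "2 * signless_q G (card (pverts G)) * (\<Sum>u\<in>pverts G. (y u)\<^sup>2)
    \<le> (\<Sum>u\<in>pverts G. \<Sum>v\<in>pverts G. of_bool ((u, v) \<in> parcs G) * (y u + y v)\<^sup>2)"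
proof -
  interpret pair_graph G by (rule G)
  let ?n = "card (pverts G)" and ?vs = "vertex_list G"
  note vs = vertex_list[OF pair_finite_verts]
  have bij: "bij_betw ((!) ?vs) {..<?n} (pverts G)"
    by (rule bij_betw_nth[OF vs(1) _ vs(2)[symmetric]]) (simp only: vs(3))
  have sym: "(u, v) \<in> parcs G \<longleftrightarrow> (v, u) \<in> parcs G" for u v
    using pair_graph_sym[OF G] unfolding sym_def by blast
  have "signless_q G ?n * (\<Sum>i<?n. (y (?vs ! i))\<^sup>2)
      \<le> (\<Sum>i<?n. \<Sum>j<?n. signless_laplacian G $$ (i, j) * y (?vs ! i) * y (?vs ! j))"
  proof (rule symmetric_mat_rayleigh[OF signless_laplacian_carrier[OF pair_finite_verts]])
    show "?n > 0" using ne pair_finite_verts by (simp add: card_gt_0_iff)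
    show "signless_laplacian G $$ (i, j) = signless_laplacian G $$ (j, i)" if "i < ?n" "j < ?n" for i j
      using that vs(3)
      by (auto simp: signless_laplacian_def degree_mat_def adjacency_mat_def Let_def sym)
    show "signless_q G ?n \<le> k" if "eigenvalue (signless_laplacian G) k" for k
      by (rule signless_q_least(2)[OF G ne that])
  qed
  moreover have "(\<Sum>i<?n. (y (?vs ! i))\<^sup>2) = (\<Sum>u\<in>pverts G. (y u)\<^sup>2)"
    by (rule sum.reindex_bij_betw[OF bij])
  ultimately show ?thesis using signless_laplacian_form[OF G, of y] by simp
qed

section \<open>Clique-freeness of the graph and the final estimate\<close>

lemma K_free_imp_clique_free:
  assumes "pair_graph G" "K_free k G"
  shows "clique_free k (parcs G) (pverts G)"
  unfolding clique_free_def
proof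
  interpret pair_graph G by (rule assms)
  assume "\<exists>C\<subseteq>pverts G. finite C \<and> card C = k \<and> (\<forall>u\<in>C. \<forall>v\<in>C. u \<noteq> v \<longrightarrow> (u, v) \<in> parcs G)"
  then obtain C where C: "C \<subseteq> pverts G" "finite C" "card C = k"
    "\<forall>u\<in>C. \<forall>v\<in>C. u \<noteq> v \<longrightarrow> (u, v) \<in> parcs G" by blast
  \<comment> \<open>The complete digraph on \<open>C\<close>: exactly the arcs between distinct
    vertices of \<open>C\<close>, all of which belong to \<open>G\<close>.\<close>
  define H where "H = \<lparr>pverts = C, parcs = {(u, v). (u, v) \<in> C \<times> C \<and> u \<noteq> v}\<rparr>"
  have "complete_digraph k (with_proj H)"
    using C by (simp add: complete_digraph_pair_def H_def)
  moreover have "wf_digraph (with_proj H)"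
    by unfold_locales (auto simp: H_def)
  then have "subgraph (with_proj H) (with_proj G)"
    using C wf_digraph by (auto simp: subgraph_def compatible_def H_def)
  ultimately show False using assms(2) by (auto simp: K_free_def)
qed

theorem theorem1p12:
  fixes G :: "'a pair_pre_digraph" and r n :: nat
  assumes "r \<ge> 1"
    and "pair_graph G" and "pverts G \<noteq> {}"
    and "card (pverts G) = n"
    and "K_free (r + 1) G"
  shows "signless_q G n / real n \<le> (1 - 1 / real r)\<^sup>2"
proof -
  interpret pair_graph G by (rule assms)
  let ?V = "pverts G" and ?R = "parcs G"
  define q where "q = signless_q G n"
  define N where "N = real n"
  define E where "E = arc_count ?R ?V ?V"
  have fin: "finite ?V" by (rule pair_finite_verts)
  have N: "N > 0" using assms fin by (auto simp: N_def card_gt_0_iff)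
  have form: "2 * q * (\<Sum>u\<in>?V. (y u)\<^sup>2) \<le> (\<Sum>u\<in>?V. \<Sum>v\<in>?V. of_bool ((u, v) \<in> ?R) * (y u + y v)\<^sup>2)" for y
    using signless_q_least_form[OF assms(2,3), of y] assms(4) by (simp add: q_def)
  have sym: "sym ?R" by (rule pair_graph_sym[OF assms(2)])
  have irr: "irrefl ?R" using pair_no_loops[of "(u, u)" for u] by (auto simp: irrefl_def)
  have free: "clique_free (Suc r) ?R ?V"
    using K_free_imp_clique_free[OF assms(2,5)] by simp
  show ?thesis
  proof (cases "r = 1")
    case True
    then have "\<forall>u\<in>?V. \<forall>v\<in>?V. (u, v) \<notin> ?R"
      using free clique_free_2_iff[OF sym irr] by (simp add: numeral_2_eq_2)
    \<comment> \<open>Without arcs the form vanishes, and the all-ones vector has squared norm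
      \<open>n > 0\<close>.\<close>
    then have "q \<le> 0"
      using form[of "\<lambda>_. 1"] N assms(4) by (simp add: N_def mult_le_0_iff)
    then show ?thesis using True N by (simp add: q_def N_def divide_nonpos_pos)
  next
    case False
    with \<open>r \<ge> 1\<close> obtain s where r: "r = Suc s" and s: "s \<ge> 1" by (cases r) auto
    from clique_free_colouring[OF s sym irr fin] free obtain f
      where f: "\<forall>u\<in>?V. f u < r"
        and le: "real s * N\<^sup>2 * mono_arc_count ?R f ?V + (real s + 1) * E\<^sup>2 \<le> real s * N\<^sup>2 * E"
      unfolding r N_def E_def assms(4)[symmetric] by blast
    define I where "I = mono_arc_count ?R f ?V"
    have "q * N * real s \<le> (real s - 1) * E + (real s + 1) * I"
      using signless_form_colouring_bound[OF fin f \<open>r \<ge> 1\<close> form] assms(4)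
      by (simp add: r N_def E_def I_def add.commute)
    \<comment> \<open>Scaling by \<open>s * N\<^sup>2\<close> allows \<open>I\<close> to be
      eliminated through \<open>le\<close>, which leaves a concave quadratic in
      \<open>E\<close>.\<close>
    then have "real s * N\<^sup>2 * (q * N * real s) \<le> real s * N\<^sup>2 * ((real s - 1) * E + (real s + 1) * I)"
      by (intro mult_left_mono) auto
    also have "\<dots> \<le> (real s - 1) * (real s * N\<^sup>2 * E) + (real s + 1) * (real s * N\<^sup>2 * E - (real s + 1) * E\<^sup>2)"
      using mult_left_mono[OF le, of "real s + 1"] by (simp add: I_def algebra_simps)
    \<comment> \<open>The factor \<open>(s + 1)\<^sup>2\<close> completes the square without
      fractions. The maximum is at \<open>E = (s / (s + 1))\<^sup>2 * N\<^sup>2\<close>, and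
      \<open>s / (s + 1)\<close> is \<open>1 - 1 / r\<close>.\<close>
    finally have "(real s + 1)\<^sup>2 * (real s * N\<^sup>2 * (q * N * real s))
        \<le> (real s + 1)\<^sup>2 * ((real s - 1) * (real s * N\<^sup>2 * E)
          + (real s + 1) * (real s * N\<^sup>2 * E - (real s + 1) * E\<^sup>2))"
      by (intro mult_left_mono) auto
    also have "\<dots> = ((real s)\<^sup>2 * N\<^sup>2)\<^sup>2 - ((real s)\<^sup>2 * N\<^sup>2 - (real s + 1)\<^sup>2 * E)\<^sup>2"
      by (simp add: power2_eq_square algebra_simps)
    also have "\<dots> \<le> ((real s)\<^sup>2 * N\<^sup>2)\<^sup>2" by simp
    finally have "((real s)\<^sup>2 * N ^ 3) * ((real s + 1)\<^sup>2 * q) \<le> ((real s)\<^sup>2 * N ^ 3) * ((real s)\<^sup>2 * N)"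
      by (simp add: power2_eq_square power3_eq_cube mult_ac)
    then have "(real s + 1)\<^sup>2 * q \<le> (real s)\<^sup>2 * N"
      using s N by (simp add: mult_le_cancel_left_pos)
    moreover have "1 - 1 / real r = real s / (real s + 1)"
      using r by (simp add: field_simps)
    ultimately show ?thesis
      using N by (simp add: q_def N_def[symmetric] power_divide field_simps)
  qed
qed

end
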